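(* Let $T,Q$ be integers with $Q\ne0$, and let $a,P,R$ be integers with $a$ nonzero and squarefree, $R\neq 0$, $\gcd(P,R)=\gcd(a,R)=1$, and $T^2R=aP^2Q$. Let $q=\frac{T^2}{Q}-2$. Then $\Pi_s(T,Q)=\Pi_s(q)$ for all $s=0,1,2,\dots$.
   Context: Dickson polynomials: for integers $T,Q$, $L_0(T,Q)=0$, $L_1(T,Q)=1$, $L_{n+1}=TL_n-QL_{n-1}$ (so for a $2\times2$ matrix $A$ with trace $T$ and determinant $Q$, $A^n=L_nA-QL_{n-1}I$), and $K_n=L_{n+1}-QL_{n-1}$ (the trace of $A^n$). Definition of $\Pi_s(T,Q)$ (relative to the chosen $a,P,R$): it consists of odd primes $p\nmid R$; if $p\mid a$ then $p$ is placed in $\Pi_1(T,Q)$ (and in no other $\Pi_s(T,Q)$); if $p\nmid a$, then $p\in\Pi_0(T,Q)$ iff $p\mid L_n(aP,aR)$ for some odd $n\ge1$, and $p\in\Pi_s(T,Q)$ ($s\ge1$) iff $p\mid K_{2^{s-1}n}(aP,aR)$ for some odd $n\ge1$. Chebyshev polynomials: $U_0=0$, $U_1=1$, $U_{n+1}=qU_n-U_{n-1}$; $C_n=U_{n+1}-U_{n-1}$; for odd $n=2k+1$, $V_n=U_{k+1}-U_k$, $W_n=U_{k+1}+U_k$. For a rational $q=c/d$ in lowest terms and an odd prime $p\nmid d$ (congruences in $\mathbb F_p$): $p\in\Pi_0(q)$ if $W_n(q)\equiv0$ for some odd $n\ge1$; $p\in\Pi_1(q)$ if $V_n(q)\equiv0$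 for some odd $n\ge1$; $p\in\Pi_{2+k}(q)$ ($k\ge0$) if $C_{2^kn}(q)\equiv0$ for some odd $n\ge1$. *)

theory Defs
  imports Main "HOL.Rat" "HOL-Computational_Algebra.Squarefree"
begin

fun dickson_L :: "int \<Rightarrow> int \<Rightarrow> nat \<Rightarrow> int" where
  "dickson_L T Q 0 = 0"
| "dickson_L T Q (Suc 0) = 1"
| "dickson_L T Q (Suc (Suc n)) = T * dickson_L T Q (Suc n) - Q * dickson_L T Q n"

text \<open>For \<open>n \<ge> 1\<close> this is \<open>K\<^sub>n = L\<^sub>n\<^sub>+\<^sub>1 - Q L\<^sub>n\<^sub>-\<^sub>1\<close>. The value at 0 is the trace of the
  identity matrix, which is also what the recurrence gives when extended to index -1.\<close>

fun dickson_K :: "int \<Rightarrow> int \<Rightarrow> nat \<Rightarrow> int" where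
  "dickson_K T Q 0 = 2"
| "dickson_K T Q (Suc n) = dickson_L T Q (Suc (Suc n)) - Q * dickson_L T Q n"

fun cheb_U :: "nat \<Rightarrow> 'a::comm_ring_1 \<Rightarrow> 'a" where
  "cheb_U 0 q = 0"
| "cheb_U (Suc 0) q = 1"
| "cheb_U (Suc (Suc n)) q = q * cheb_U (Suc n) q - cheb_U n q"

text \<open>The value at 0 is \<open>U\<^sub>1 - U\<^sub>-\<^sub>1\<close> with \<open>U\<^sub>-\<^sub>1 = -1\<close>.\<close>

fun cheb_C :: "nat \<Rightarrow> 'a::comm_ring_1 \<Rightarrow> 'a" where
  "cheb_C 0 q = 2"
| "cheb_C (Suc n) q = cheb_U (Suc (Suc n)) q - cheb_U n q"

text \<open>The next two are meaningful for odd \<open>n = 2 * k + 1\<close> only; then \<open>n div 2 = k\<close>.\<close>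

definition cheb_V :: "nat \<Rightarrow> 'a::comm_ring_1 \<Rightarrow> 'a" where
  "cheb_V n q = cheb_U (n div 2 + 1) q - cheb_U (n div 2) q"

definition cheb_W :: "nat \<Rightarrow> 'a::comm_ring_1 \<Rightarrow> 'a" where
  "cheb_W n q = cheb_U (n div 2 + 1) q + cheb_U (n div 2) q"

text \<open>\<open>\<Pi>\<^sub>s(T,Q)\<close>: the pair \<open>(T,Q)\<close> enters only through the chosen \<open>a, P, R\<close> with
  \<open>T\<^sup>2 R = a P\<^sup>2 Q\<close>. A prime of type \<open>int\<close> is positive.\<close>

definition Pi_pair :: "int \<Rightarrow> int \<Rightarrow> int \<Rightarrow> nat \<Rightarrow> int set" where
  "Pi_pair a P R s = {p. prime p \<and> odd p \<and> \<not> p dvd R \<and>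
     (if p dvd a then s = 1
      else if s = 0 then (\<exists>n. odd n \<and> p dvd dickson_L (a * P) (a * R) n)
      else (\<exists>n. odd n \<and> p dvd dickson_K (a * P) (a * R) (2 ^ (s - 1) * n)))}"

text \<open>\<open>quotient_of x\<close> is the pair of numerator and denominator in lowest terms. If \<open>p\<close> does not
  divide the denominator, \<open>x\<close> has a residue in the field with \<open>p\<close> elements, and this residue is 0
  iff \<open>p\<close> divides the numerator.\<close>

definition rat_zero_mod :: "int \<Rightarrow> rat \<Rightarrow> bool" where
  "rat_zero_mod p x \<longleftrightarrow> \<not> p dvd snd (quotient_of x) \<and> p dvd fst (quotient_of x)"

definition Pi_rat :: "rat \<Rightarrow> nat \<Rightarrow> int set" where
  "Pi_rat q s = {p. prime p \<and> odd p \<and> \<not> p dvd snd (quotient_of q) \<and>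
     (if s = 0 then (\<exists>n. odd n \<and> rat_zero_mod p (cheb_W n q))
      else if s = 1 then (\<exists>n. odd n \<and> rat_zero_mod p (cheb_V n q))
      else (\<exists>n. odd n \<and> rat_zero_mod p (cheb_C (2 ^ (s - 2) * n) q)))}"

end

theory Submission
  imports Defs
begin

text \<open>Put \<open>t = a P\<close> and \<open>r = a R\<close>, so that \<open>q = t\<^sup>2 / r - 2\<close>. Then \<open>L\<^sub>2\<^sub>k\<^sub>+\<^sub>1(t,r) = r\<^sup>k W\<^sub>2\<^sub>k\<^sub>+\<^sub>1(q)\<close>,
  \<open>K\<^sub>2\<^sub>k\<^sub>+\<^sub>1(t,r) = t r\<^sup>k V\<^sub>2\<^sub>k\<^sub>+\<^sub>1(q)\<close> and \<open>K\<^sub>2\<^sub>k(t,r) = r\<^sup>k C\<^sub>k(q)\<close>. For \<open>p\<close> not dividing \<open>a R\<close>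
  the factor \<open>r\<^sup>k\<close> is a unit modulo \<open>p\<close>, so the two classifications can only differ in the
  factor \<open>t\<close>. If \<open>p\<close> divides \<open>a P\<close> then \<open>q \<equiv> -2\<close>, and the Chebyshev values at \<open>-2\<close> are
  \<open>W\<^sub>n = \<plusminus>1\<close>, \<open>V\<^sub>n = \<plusminus>n\<close>, \<open>C\<^sub>n = \<plusminus>2\<close>, which puts \<open>p\<close> into \<open>\<Pi>\<^sub>1(q)\<close> (take \<open>n = p\<close>) and into no
  other class.\<close>

section \<open>Rational numbers modulo a prime\<close>

lemma quotient_of_cross:
  assumes "x = of_int N / of_int D" "D \<noteq> 0"
  shows "fst (quotient_of x) * D = N * snd (quotient_of x)"
proof -
  obtain n d where nd: "quotient_of x = (n, d)" by fastforce
  have d: "d > 0" using quotient_of_denom_pos[OF nd] .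
  have "of_int n / of_int d = (of_int N / of_int D :: rat)"
    using quotient_of_div[OF nd] assms(1) by simp
  hence "of_int (n * D) = (of_int (N * d) :: rat)"
    using d assms(2) by (simp add: field_simps)
  thus ?thesis using nd by (simp only: of_int_eq_iff fst_conv snd_conv)
qed

lemma prime_not_dvd_quotient_of:
  assumes "prime p"
  shows "\<not> (p dvd fst (quotient_of x) \<and> p dvd snd (quotient_of x))"
proof -
  have "coprime (fst (quotient_of x)) (snd (quotient_of x))"
    by (rule quotient_of_coprime) simp
  thus ?thesis using assms coprime_common_divisor not_prime_unit by blast
qed

text \<open>If \<open>p\<close> divided the reduced denominator, clearing denominators would force
  it into the reduced numerator too, contradicting lowest terms.\<close>

lemma prime_not_dvd_denominator:
  assumes "prime p" "\<not> p dvd D" "x = of_int N / of_int D"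
  shows "\<not> p dvd snd (quotient_of x)"
proof
  assume "p dvd snd (quotient_of x)"
  moreover have "D \<noteq> 0" using assms(2) by auto
  ultimately have "p dvd fst (quotient_of x) * D"
    using quotient_of_cross[OF assms(3)] by simp
  with \<open>p dvd snd (quotient_of x)\<close> show False
    using assms(1,2) prime_not_dvd_quotient_of prime_dvd_mult_iff by blast
qed

text \<open>With \<open>D = R\<close>, this matches the primes excluded in \<open>Pi_pair\<close>
  with those excluded in \<open>Pi_rat\<close>.\<close>

lemma prime_dvd_denominator_iff:
  assumes "prime p" "coprime N D" "D \<noteq> 0" "x = of_int N / of_int D"
  shows "p dvd snd (quotient_of x) \<longleftrightarrow> p dvd D"
proof
  assume "p dvd D"
  hence "p dvd N * snd (quotient_of x)"
    using quotient_of_cross[OF assms(4,3)] by (metis dvd_mult)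
  moreover have "\<not> p dvd N"
    using \<open>p dvd D\<close> assms(1,2) coprime_common_divisor not_prime_unit by blast
  ultimately show "p dvd snd (quotient_of x)"
    using assms(1) prime_dvd_mult_iff by blast
qed (use prime_not_dvd_denominator[OF assms(1) _ assms(4)] in blast)

text \<open>After cross-multiplication with the reduced fraction both denominators are units modulo
  \<open>p\<close>, so the numerators vanish together. Later \<open>D\<close> is built from powers
  of \<open>a * R\<close>, and the fraction need not be reduced.\<close>

lemma rat_zero_mod_iff:
  assumes "prime p" "\<not> p dvd D" "x = of_int N / of_int D"
  shows "rat_zero_mod p x \<longleftrightarrow> p dvd N"
proof -
  have "D \<noteq> 0" using assms(2) by auto
  hence cross: "fst (quotient_of x) * D = N * snd (quotient_of x)"
    using quotient_of_cross assms(3) by blast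
  have den: "\<not> p dvd snd (quotient_of x)"
    using prime_not_dvd_denominator assms by blast
  have "p dvd fst (quotient_of x) \<longleftrightarrow> p dvd fst (quotient_of x) * D"
    using assms(1,2) by (simp add: prime_dvd_mult_iff)
  also have "\<dots> \<longleftrightarrow> p dvd N"
    using cross assms(1) den by (simp add: prime_dvd_mult_iff)
  finally show ?thesis using den by (simp add: rat_zero_mod_def)
qed

text \<open>For prime \<open>p\<close>, the fractions \<open>p * N / D\<close> form the maximal
  ideal of the integers localized at \<open>p\<close>, so this is congruence modulo that ideal. The
  integer representative \<open>z\<close> lets polynomial values be computed over
  \<open>int\<close>.\<close>

definition rat_cong :: "int \<Rightarrow> rat \<Rightarrow> int \<Rightarrow> bool" where
  "rat_cong p x z \<longleftrightarrow> (\<exists>N D. \<not> p dvd D \<and> x = of_int z + of_int (p * N) / of_int D)"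

lemma rat_cong_of_int: "prime p \<Longrightarrow> rat_cong p (of_int z) z"
  unfolding rat_cong_def by (rule exI[of _ 0], rule exI[of _ 1]) (auto dest: not_prime_unit)

lemma rat_cong_add:
  assumes "prime p" "rat_cong p x z" "rat_cong p y w"
  shows "rat_cong p (x + y) (z + w)"
proof -
  obtain N D where x: "\<not> p dvd D" "x = of_int z + of_int (p * N) / of_int D"
    using assms(2) unfolding rat_cong_def by blast
  obtain M E where y: "\<not> p dvd E" "y = of_int w + of_int (p * M) / of_int E"
    using assms(3) unfolding rat_cong_def by blast
  have nz: "D \<noteq> 0" "E \<noteq> 0" using x(1) y(1) by auto
  have "\<not> p dvd D * E" using assms(1) x(1) y(1) by (simp add: prime_dvd_mult_iff)
  moreover have "x + y = of_int (z + w) + of_int (p * (N * E + M * D)) / of_int (D * E)"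
    unfolding x(2) y(2) using nz by (simp add: field_simps)
  ultimately show ?thesis unfolding rat_cong_def by blast
qed

lemma rat_cong_mult:
  assumes "prime p" "rat_cong p x z" "rat_cong p y w"
  shows "rat_cong p (x * y) (z * w)"
proof -
  obtain N D where x: "\<not> p dvd D" "x = of_int z + of_int (p * N) / of_int D"
    using assms(2) unfolding rat_cong_def by blast
  obtain M E where y: "\<not> p dvd E" "y = of_int w + of_int (p * M) / of_int E"
    using assms(3) unfolding rat_cong_def by blast
  have nz: "D \<noteq> 0" "E \<noteq> 0" using x(1) y(1) by auto
  have "\<not> p dvd D * E" using assms(1) x(1) y(1) by (simp add: prime_dvd_mult_iff)
  moreover have "x * y = of_int (z * w)
      + of_int (p * (z * M * D + w * N * E + p * N * M)) / of_int (D * E)"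
    unfolding x(2) y(2) using nz by (simp add: field_simps)
  ultimately show ?thesis unfolding rat_cong_def by blast
qed

lemma rat_cong_diff:
  assumes "prime p" "rat_cong p x z" "rat_cong p y w"
  shows "rat_cong p (x - y) (z - w)"
  using rat_cong_add[OF assms(1,2) rat_cong_mult[OF assms(1) rat_cong_of_int[OF assms(1), of "-1"] assms(3)]]
  by simp

lemma rat_zero_mod_cong_iff:
  assumes "prime p" "rat_cong p x z"
  shows "rat_zero_mod p x \<longleftrightarrow> p dvd z"
proof -
  obtain N D where x: "\<not> p dvd D" "x = of_int z + of_int (p * N) / of_int D"
    using assms(2) unfolding rat_cong_def by blast
  have "D \<noteq> 0" using x(1) by auto
  hence "x = of_int (z * D + p * N) / of_int D"
    using x(2) by (simp add: field_simps)
  hence "rat_zero_mod p x \<longleftrightarrow> p dvd z * D + p * N"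
    using rat_zero_mod_iff assms(1) x(1) by blast
  also have "\<dots> \<longleftrightarrow> p dvd z"
    using assms(1) x(1) by (simp add: dvd_add_left_iff prime_dvd_mult_iff)
  finally show ?thesis .
qed

section \<open>Chebyshev polynomials modulo a prime and their values at -2\<close>

lemma rat_cong_cheb_U:
  assumes "prime p" "rat_cong p x z"
  shows "rat_cong p (cheb_U n x) (cheb_U n z)"
proof (induction n rule: induct_nat_012)
  case 0
  show ?case using rat_cong_of_int[OF assms(1), of 0] by simp
next
  case 1
  show ?case using rat_cong_of_int[OF assms(1), of 1] by simp
next
  case (ge2 n)
  show ?case unfolding cheb_U.simps(3)
    by (intro rat_cong_diff rat_cong_mult assms ge2)
qed

lemma rat_cong_cheb_C:
  assumes "prime p" "rat_cong p x z"
  shows "rat_cong p (cheb_C n x) (cheb_C n z)"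
proof (cases n)
  case 0
  thus ?thesis using rat_cong_of_int[OF assms(1), of 2] by simp
next
  case (Suc m)
  show ?thesis unfolding Suc cheb_C.simps(2)
    by (intro rat_cong_diff rat_cong_cheb_U assms)
qed

text \<open>At -2 the recurrence has characteristic polynomial (X + 1)^2, and the double root -1
  gives n (-1)^(n-1). The exponent \<open>Suc n\<close> has the same parity as n-1 without
  natural-number subtraction.\<close>

lemma cheb_U_minus_two: "cheb_U n (-2 :: int) = (-1) ^ Suc n * int n"
by (induction n rule: induct_nat_012) (simp_all add: algebra_simps)

lemma cheb_V_minus_two:
  assumes "odd n"
  shows "cheb_V n (-2 :: int) = (-1) ^ (n div 2) * int n"
proof -
  obtain k where "n = 2 * k + 1" using assms oddE by blast
  thus ?thesis by (simp add: cheb_V_def cheb_U_minus_two algebra_simps)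
qed

lemma cheb_W_minus_two: "cheb_W n (-2 :: int) = (-1) ^ (n div 2)"
  by (simp add: cheb_W_def cheb_U_minus_two algebra_simps)

lemma cheb_C_minus_two: "cheb_C n (-2 :: int) = (-1) ^ n * 2"
  by (cases n) (simp_all add: cheb_U_minus_two algebra_simps)

lemma prime_not_dvd_minus_one_power: "prime (p :: int) \<Longrightarrow> \<not> p dvd (-1) ^ k"
  using prime_dvd_power not_prime_unit by (metis dvd_minus_iff)

text \<open>Used for the primes dividing \<open>a * P\<close>. Values at \<open>x\<close> may be
  read off at -2, where those of \<open>W\<close> and \<open>C\<close> are units modulo an odd
  prime.\<close>

lemma cong_minus_two_zero_mod:
  fixes p :: int
  assumes p: "prime p" "odd p" and x: "rat_cong p x (-2)"
  shows "\<not> rat_zero_mod p (cheb_W n x)" "\<not> rat_zero_mod p (cheb_C n x)"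
    and "\<exists>n. odd n \<and> rat_zero_mod p (cheb_V n x)"
proof -
  have "rat_cong p (cheb_W n x) (cheb_W n (-2))"
    unfolding cheb_W_def by (intro rat_cong_add rat_cong_cheb_U p x)
  thus "\<not> rat_zero_mod p (cheb_W n x)"
    using p by (simp add: rat_zero_mod_cong_iff cheb_W_minus_two prime_not_dvd_minus_one_power)
  have "\<not> p dvd 2"
    using p by (metis dvd_refl prime_ge_2_int zdvd_not_zless order_le_less zero_less_numeral)
  hence "\<not> p dvd (-1) ^ n * 2"
    using p(1) prime_not_dvd_minus_one_power prime_dvd_mult_iff by blast
  thus "\<not> rat_zero_mod p (cheb_C n x)"
    using rat_zero_mod_cong_iff[OF p(1) rat_cong_cheb_C[OF p(1) x]] cheb_C_minus_two by metis
  \<comment> \<open>The witness is the index \<open>n = p\<close>, moved to \<open>nat\<close>: it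
    is odd, and the value of V_p at -2 is p up to sign.\<close>
  have "int (nat p) = p" using p(1) by (simp add: prime_ge_0_int)
  hence odd: "odd (nat p)" using p(2) by (metis even_of_nat_iff)
  have "rat_cong p (cheb_V (nat p) x) (cheb_V (nat p) (-2))"
    unfolding cheb_V_def by (intro rat_cong_diff rat_cong_cheb_U p x)
  hence "rat_zero_mod p (cheb_V (nat p) x)"
    using p odd \<open>int (nat p) = p\<close> by (simp add: rat_zero_mod_cong_iff cheb_V_minus_two)
  thus "\<exists>n. odd n \<and> rat_zero_mod p (cheb_V n x)" using odd by blast
qed

section \<open>Dickson polynomials as multiples of Chebyshev polynomials\<close>

context
  fixes t r :: int and q :: "'a :: comm_ring_1"
  assumes q: "of_int t ^ 2 = of_int r * (q + 2)"
begin

text \<open>Each step of the recurrence mixes both parities, hence the joint induction. The relation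
  t^2 = r (q + 2) removes t^2, and (q + 2) U_{k+1} - (U_{k+1} + U_k) = U_{k+2} + U_{k+1}.\<close>

lemma dickson_L_cheb:
  "of_int (dickson_L t r (Suc (2 * k))) = of_int r ^ k * (cheb_U (Suc k) q + cheb_U k q)"
  "of_int (dickson_L t r (Suc (Suc (2 * k)))) = of_int t * of_int r ^ k * cheb_U (Suc k) q"
proof (induction k)
  case 0
  show "of_int (dickson_L t r (Suc (2 * 0))) = of_int r ^ 0 * (cheb_U (Suc 0) q + cheb_U 0 q)"
    "of_int (dickson_L t r (Suc (Suc (2 * 0)))) = of_int t * of_int r ^ 0 * cheb_U (Suc 0) q"
    by simp_all
next
  case (Suc k)
  have "of_int (dickson_L t r (Suc (2 * Suc k)))
      = of_int t ^ 2 * of_int r ^ k * cheb_U (Suc k) q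
        - of_int r * (of_int r ^ k * (cheb_U (Suc k) q + cheb_U k q))"
    using Suc by (simp add: power2_eq_square mult.assoc)
  also have "\<dots> = of_int r ^ Suc k * (cheb_U (Suc (Suc k)) q + cheb_U (Suc k) q)"
    unfolding q by (simp add: algebra_simps)
  finally show odd: "of_int (dickson_L t r (Suc (2 * Suc k)))
      = of_int r ^ Suc k * (cheb_U (Suc (Suc k)) q + cheb_U (Suc k) q)" .
  have "of_int (dickson_L t r (Suc (Suc (2 * Suc k))))
      = of_int t * of_int (dickson_L t r (Suc (2 * Suc k)))
        - of_int r * (of_int (dickson_L t r (Suc (Suc (2 * k)))) :: 'a)"
    by simp
  also have "\<dots> = of_int t * of_int r ^ Suc k * cheb_U (Suc (Suc k)) q"
    unfolding odd Suc by (simp add: algebra_simps)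
  finally show "of_int (dickson_L t r (Suc (Suc (2 * Suc k))))
      = of_int t * of_int r ^ Suc k * cheb_U (Suc (Suc k)) q" .
qed

lemma dickson_L_odd:
  "odd n \<Longrightarrow> of_int (dickson_L t r n) = of_int r ^ (n div 2) * cheb_W n q"
  by (elim oddE) (simp add: cheb_W_def dickson_L_cheb del: dickson_L.simps)

lemma dickson_K_odd:
  assumes "odd n"
  shows "of_int (dickson_K t r n) = of_int t * of_int r ^ (n div 2) * cheb_V n q"
proof -
  obtain k where n: "n = 2 * k + 1" using assms oddE by blast
  \<comment> \<open>The factor \<open>r\<close> keeps the exponent at \<open>k\<close> instead of
    k-1, so that \<open>k = 0\<close> is covered: both sides are then 0.\<close>
  have "of_int r * of_int (dickson_L t r (2 * k)) = of_int t * of_int r ^ k * cheb_U k q"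
    by (cases k) (simp_all add: dickson_L_cheb del: dickson_L.simps(3))
  moreover have "of_int (dickson_K t r n) = of_int (dickson_L t r (Suc (Suc (2 * k))))
      - of_int r * (of_int (dickson_L t r (2 * k)) :: 'a)"
    by (simp add: n)
  ultimately show ?thesis
    unfolding dickson_L_cheb n cheb_V_def by (simp add: algebra_simps)
qed

text \<open>For positive \<open>k\<close> the terms U_k cancel in (U_{k+1} + U_k) - (U_k + U_{k-1});
  for \<open>k = 0\<close> both sides are 2.\<close>

lemma dickson_K_even: "of_int (dickson_K t r (2 * k)) = of_int r ^ k * cheb_C k q"
proof (cases k)
  case (Suc m)
  have "of_int (dickson_K t r (2 * k)) = of_int (dickson_L t r (Suc (2 * Suc m)))
      - of_int r * (of_int (dickson_L t r (Suc (2 * m))) :: 'a)"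
    by (simp add: Suc)
  thus ?thesis unfolding dickson_L_cheb Suc by (simp add: algebra_simps)
qed simp

end

section \<open>Comparison of the two classifications\<close>

theorem theorem21:
  fixes T Q a P R :: int and q :: rat
  assumes "Q \<noteq> 0"
    and "a \<noteq> 0" and "squarefree a" and "R \<noteq> 0"
    and "gcd P R = 1" and "gcd a R = 1"
    and "T\<^sup>2 * R = a * P\<^sup>2 * Q"
    and "q = (of_int T)\<^sup>2 / of_int Q - 2"
  shows "\<forall>s. Pi_pair a P R s = Pi_rat q s"
proof (intro allI set_eqI)
  fix s p
  have "(of_int (T\<^sup>2 * R) :: rat) = of_int (a * P\<^sup>2 * Q)"
    using assms(7) by (simp only:)
  hence q: "q + 2 = of_int (a * P\<^sup>2) / of_int R"
    unfolding assms(8) using assms(1,4) by (simp add: field_simps)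
  hence qN: "q = of_int (a * P\<^sup>2 - 2 * R) / of_int R"
    using assms(4) by (simp add: field_simps)
  \<comment> \<open>Adding a multiple of \<open>R\<close> preserves the gcd, so the fraction in
    \<open>qN\<close> is in lowest terms up to sign.\<close>
  have "coprime (a * P\<^sup>2) R"
    using assms(5,6) by (simp flip: coprime_iff_gcd_eq_1)
  moreover have "gcd (a * P\<^sup>2 + (-2) * R) R = gcd (a * P\<^sup>2) R"
    by (metis gcd_add_mult gcd.commute add.commute)
  ultimately have cop: "coprime (a * P\<^sup>2 - 2 * R) R"
    by (simp add: coprime_iff_gcd_eq_1)
  have tr: "of_int (a * P) ^ 2 = of_int (a * R) * (q + 2)"
    unfolding q using assms(4) by (simp add: power2_eq_square)
  have minus_two: "rat_cong p q (-2)" if "\<not> p dvd R" "p dvd a * P"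
  proof -
    obtain N where "a * P = p * N" using \<open>p dvd a * P\<close> by blast
    hence "a * P\<^sup>2 = p * (N * P)" by (simp add: power2_eq_square)
    hence "q = of_int (-2) + of_int (p * (N * P)) / of_int R"
      using q by (simp add: field_simps)
    thus ?thesis unfolding rat_cong_def using that(1) by blast
  qed
  show "p \<in> Pi_pair a P R s \<longleftrightarrow> p \<in> Pi_rat q s"
  proof (cases "prime p \<and> odd p \<and> \<not> p dvd R")
    case False
    thus ?thesis unfolding Pi_pair_def Pi_rat_def
      using prime_dvd_denominator_iff[OF _ cop assms(4) qN] by blast
  next
    case True
    hence p: "prime p" "odd p" "\<not> p dvd R" by auto
    have den: "\<not> p dvd snd (quotient_of q)"
      using p prime_dvd_denominator_iff[OF _ cop assms(4) qN] by blast
    show ?thesis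
    proof (cases "p dvd a")
      case a: True
      have "rat_cong p q (-2)" using minus_two p(3) a by simp
      thus ?thesis using p a den cong_minus_two_zero_mod[OF p(1,2)]
        by (auto simp: Pi_pair_def Pi_rat_def)
    next
      case a: False
      \<comment> \<open>Powers of \<open>a * R\<close> are units modulo \<open>p\<close>. Since the
        formulas for \<open>W\<close> and \<open>C\<close> contain no factor \<open>a * P\<close>,
        \<open>transfer\<close> handles them without asking whether \<open>p\<close> divides
        \<open>P\<close>.\<close>
      have r: "\<not> p dvd (a * R) ^ k" for k
        using a p by (metis prime_dvd_mult_iff prime_dvd_power)
      hence r0: "of_int (a * R) ^ k \<noteq> (0 :: rat)" for k
        by (metis dvd_0_right of_int_0_eq_iff of_int_power)
      have transfer: "rat_zero_mod p x \<longleftrightarrow> p dvd N"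
        if "of_int N = of_int (a * R) ^ k * x" for x N k
        by (rule rat_zero_mod_iff[OF p(1) r[of k]]) (use that r0[of k] in simp)
      have L: "rat_zero_mod p (cheb_W n q) \<longleftrightarrow> p dvd dickson_L (a * P) (a * R) n"
        if "odd n" for n
        by (rule transfer[OF dickson_L_odd[OF tr that]])
      have C: "rat_zero_mod p (cheb_C k q) \<longleftrightarrow> p dvd dickson_K (a * P) (a * R) (2 * k)" for k
        by (rule transfer[OF dickson_K_even[OF tr]])
      \<comment> \<open>The factor \<open>a * P\<close> enters here. If \<open>p\<close> divides it,
        the equivalence may fail for a single \<open>n\<close>, but both existential statements
        hold: K_1 equals \<open>a * P\<close>, and V vanishes at index \<open>p\<close>. Otherwise
        the factor is a unit and the equivalence holds for each odd \<open>n\<close>.\<close>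
      have K: "(\<exists>n. odd n \<and> rat_zero_mod p (cheb_V n q))
          \<longleftrightarrow> (\<exists>n. odd n \<and> p dvd dickson_K (a * P) (a * R) n)"
      proof (cases "p dvd a * P")
        case aP: True
        have "p dvd dickson_K (a * P) (a * R) 1" using aP by simp
        thus ?thesis
          using cong_minus_two_zero_mod(3)[OF p(1,2) minus_two[OF p(3) aP]] odd_one by blast
      next
        case aP: False
        have "rat_zero_mod p (cheb_V n q) \<longleftrightarrow> p dvd dickson_K (a * P) (a * R) n"
          if "odd n" for n
        proof (rule rat_zero_mod_iff)
          show "\<not> p dvd a * P * (a * R) ^ (n div 2)"
            using aP r p(1) prime_dvd_mult_iff by blast
          show "cheb_V n q = of_int (dickson_K (a * P) (a * R) n)
              / of_int (a * P * (a * R) ^ (n div 2))"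
            unfolding dickson_K_odd[OF tr that] using aP r0[of "n div 2"] by auto
        qed (fact p)
        thus ?thesis by blast
      qed
      \<comment> \<open>The shift from \<open>s - 2\<close> to \<open>s - 1\<close> is the doubling
        of the index in \<open>dickson_K_even\<close>; it needs s at least 2, because of truncated
        subtraction.\<close>
      have C': "rat_zero_mod p (cheb_C (2 ^ (s - 2) * n) q)
          \<longleftrightarrow> p dvd dickson_K (a * P) (a * R) (2 ^ (s - 1) * n)"
        if "s \<noteq> 0" "s \<noteq> 1" for n
      proof -
        have "s - 1 = Suc (s - 2)" using that by simp
        thus ?thesis using C by (simp only: power_Suc mult.assoc)
      qed
      thus ?thesis using p a den L K C'
        by (auto simp: Pi_pair_def Pi_rat_def)
    qed
  qed
qed

end
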